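(* Let $T>0$. Assume: (i) $\Delta_2$ is invertible; (ii) the reduced algebraic Riccati equation $A_{22}^*\overline P_{22}+\overline P_{22}A_{22}+\overline P_{22}\Delta_2\overline P_{22}+Q_2=0$ admits a stabilising solution $\overline P_{22}^+\in\mathbb S^{n_2}$, i.e. all eigenvalues of $A_{22}+\Delta_2\overline P_{22}^+$ have strictly negative real parts; (iii) the reduced differential Riccati equation $\frac{d\overline P_{11}}{dt}+\widetilde A^*\overline P_{11}+\overline P_{11}\widetilde A+\overline P_{11}M\overline P_{11}+N=0$ on $[0,T]$, $\overline P_{11}(T)=0$, admits a unique solution $\overline P_{11}^+\in C([0,T];\mathbb S^{n_1})$. Then $(\overline P_{11}^+,\overline P_{12},\overline P_{22}^+)\in C([0,T];\mathbb S^{n_1})\times C([0,T];\mathbb R^{n_1\times n_2})\times\mathbb S^{n_2}$, where $$\overline P_{12}(t)=-\big(A_{21}^*\overline P_{22}^++\overline P_{11}^+(t)A_{12}+\overline P_{11}^+(t)\Delta\overline P_{22}^+\big)\big(A_{22}+\Delta_2\overline P_{22}^+\big)^{-1},\quad t\in[0,T],$$ is a solution of the reduced system $$\frac{d\overline P_{11}}{dt}+f(\overline P_{11},\overline P_{12},\overline P_{22},0)=0,\ \ \overline P_{11}(T)=0,\qquad g_1(\overline P_{11},\overline P_{12},\overline P_{22},0)=0,\qquad g_2(\overline P_{11},\overline P_{12},\overline P_{22},0)=0.$$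
   Context: Notation: $M^*$ is the transpose of $M$; $\mathbb S^m$ is the space of symmetric $m\times m$ real matrices. Data: $n_1,n_2,k_1,k_2\ge1$ are integers; for $i,j\in\{1,2\}$, $A_{ij}\in\mathbb R^{n_i\times n_j}$, $B_{ij}\in\mathbb R^{n_i\times k_j}$, $Q_i\in\mathbb S^{n_i}$ are constant matrices. Put $\Delta_1=B_{11}B_{11}^*-B_{12}B_{12}^*$, $\Delta=B_{11}B_{21}^*-B_{12}B_{22}^*$, $\Delta_2=B_{21}B_{21}^*-B_{22}B_{22}^*$. Functions: $f(P_{11},P_{12},P_{22},\epsilon)=A_{11}^*P_{11}+A_{21}^*P_{12}^*+P_{11}A_{11}+P_{12}A_{21}+P_{11}\Delta_1P_{11}+P_{12}\Delta^*P_{11}+P_{11}\Delta P_{12}^*+P_{12}\Delta_2P_{12}^*+Q_1$; $g_1(P_{11},P_{12},P_{22},\epsilon)=\epsilon A_{11}^*P_{12}+A_{21}^*P_{22}+P_{11}A_{12}+P_{12}A_{22}+\epsilon P_{11}\Delta_1P_{12}+\epsilon P_{12}\Delta^*P_{12}+P_{11}\Delta P_{22}+P_{12}\Delta_2P_{22}$; $g_2(P_{11},P_{12},P_{22},\epsilon)=\epsilon A_{12}^*P_{12}+A_{22}^*P_{22}+\epsilon P_{12}^*A_{12}+P_{22}A_{22}+\epsilon^2P_{12}^*\Delta_1P_{12}+\epsilon P_{12}^*\Delta P_{22}+\epsilon P_{22}\Delta^*P_{12}+P_{22}\Delta_2P_{22}+Q_2$. Coefficients of the reduced differential Riccati equation: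 with $\Lambda=A_{22}^*\Delta_2^{-1}A_{22}-Q_2$ (which is invertible under (i) and (ii)), $\widetilde A=A_{11}-\Delta\Delta_2^{-1}[\Delta_2-A_{22}\Lambda^{-1}A_{22}^*]\Delta_2^{-1}A_{21}-A_{12}\Lambda^{-1}A_{22}^*\Delta_2^{-1}A_{21}$; $M=\Delta_1+A_{12}\Lambda^{-1}A_{12}^*-\Delta\Delta_2^{-1}A_{22}\Lambda^{-1}A_{12}^*-A_{12}\Lambda^{-1}A_{22}^*\Delta_2^{-1}\Delta^*-\Delta\Delta_2^{-1}[\Delta_2-A_{22}\Lambda^{-1}A_{22}^*]\Delta_2^{-1}\Delta^*$; $N=Q_1-A_{21}^*\Delta_2^{-1}[\Delta_2-A_{22}\Lambda^{-1}A_{22}^*]\Delta_2^{-1}A_{21}$. *)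

theory Defs
  imports "HOL-Analysis.Analysis"
begin

notation transpose ("_\<^sup>T" [1000] 999)

(* The type real^'n^'m is the space of real matrices with rows indexed by 'm and
   columns indexed by 'n, so n1, n2, k1, k2 are the cardinalities of the index types. *)
record ('n1, 'n2, 'k1, 'k2) riccati_data =
  A11 :: "real^'n1::finite^'n1" ("A\<^sub>1\<^sub>1\<index>")
  A12 :: "real^'n2::finite^'n1" ("A\<^sub>1\<^sub>2\<index>")
  A21 :: "real^'n1^'n2" ("A\<^sub>2\<^sub>1\<index>")
  A22 :: "real^'n2^'n2" ("A\<^sub>2\<^sub>2\<index>")
  B11 :: "real^'k1::finite^'n1" ("B\<^sub>1\<^sub>1\<index>")
  B12 :: "real^'k2::finite^'n1" ("B\<^sub>1\<^sub>2\<index>")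
  B21 :: "real^'k1^'n2" ("B\<^sub>2\<^sub>1\<index>")
  B22 :: "real^'k2^'n2" ("B\<^sub>2\<^sub>2\<index>")
  Q1 :: "real^'n1^'n1" ("Q\<^sub>1\<index>")
  Q2 :: "real^'n2^'n2" ("Q\<^sub>2\<index>")

definition Delta1 :: "('n1::finite, 'n2::finite, 'k1::finite, 'k2::finite) riccati_data \<Rightarrow> real^'n1^'n1"
    ("\<Delta>\<^sub>1\<index>") where
  "\<Delta>\<^sub>1 = B\<^sub>1\<^sub>1 ** B\<^sub>1\<^sub>1\<^sup>T - B\<^sub>1\<^sub>2 ** B\<^sub>1\<^sub>2\<^sup>T" for S (structure)

definition Delta :: "('n1::finite, 'n2::finite, 'k1::finite, 'k2::finite) riccati_data \<Rightarrow> real^'n2^'n1"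
    ("\<Delta>\<index>") where
  "\<Delta> = B\<^sub>1\<^sub>1 ** B\<^sub>2\<^sub>1\<^sup>T - B\<^sub>1\<^sub>2 ** B\<^sub>2\<^sub>2\<^sup>T" for S (structure)

definition Delta2 :: "('n1::finite, 'n2::finite, 'k1::finite, 'k2::finite) riccati_data \<Rightarrow> real^'n2^'n2"
    ("\<Delta>\<^sub>2\<index>") where
  "\<Delta>\<^sub>2 = B\<^sub>2\<^sub>1 ** B\<^sub>2\<^sub>1\<^sup>T - B\<^sub>2\<^sub>2 ** B\<^sub>2\<^sub>2\<^sup>T" for S (structure)

definition ric_f ::
  "('n1::finite, 'n2::finite, 'k1::finite, 'k2::finite) riccati_data \<Rightarrow>
     real^'n1^'n1 \<Rightarrow> real^'n2^'n1 \<Rightarrow> real^'n2^'n2 \<Rightarrow> real \<Rightarrow> real^'n1^'n1" where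
  "ric_f S P11 P12 P22 \<epsilon> =
     A\<^sub>1\<^sub>1\<^sup>T ** P11 + A\<^sub>2\<^sub>1\<^sup>T ** P12\<^sup>T + P11 ** A\<^sub>1\<^sub>1 + P12 ** A\<^sub>2\<^sub>1
     + P11 ** \<Delta>\<^sub>1 ** P11 + P12 ** \<Delta>\<^sup>T ** P11 + P11 ** \<Delta> ** P12\<^sup>T
     + P12 ** \<Delta>\<^sub>2 ** P12\<^sup>T + Q\<^sub>1" for S (structure)

definition ric_g1 ::
  "('n1::finite, 'n2::finite, 'k1::finite, 'k2::finite) riccati_data \<Rightarrow>
     real^'n1^'n1 \<Rightarrow> real^'n2^'n1 \<Rightarrow> real^'n2^'n2 \<Rightarrow> real \<Rightarrow> real^'n2^'n1" where
  "ric_g1 S P11 P12 P22 \<epsilon> =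
     \<epsilon> *\<^sub>R (A\<^sub>1\<^sub>1\<^sup>T ** P12) + A\<^sub>2\<^sub>1\<^sup>T ** P22 + P11 ** A\<^sub>1\<^sub>2 + P12 ** A\<^sub>2\<^sub>2
     + \<epsilon> *\<^sub>R (P11 ** \<Delta>\<^sub>1 ** P12) + \<epsilon> *\<^sub>R (P12 ** \<Delta>\<^sup>T ** P12)
     + P11 ** \<Delta> ** P22 + P12 ** \<Delta>\<^sub>2 ** P22" for S (structure)

definition ric_g2 ::
  "('n1::finite, 'n2::finite, 'k1::finite, 'k2::finite) riccati_data \<Rightarrow>
     real^'n1^'n1 \<Rightarrow> real^'n2^'n1 \<Rightarrow> real^'n2^'n2 \<Rightarrow> real \<Rightarrow> real^'n2^'n2" where
  "ric_g2 S P11 P12 P22 \<epsilon> =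
     \<epsilon> *\<^sub>R (A\<^sub>1\<^sub>2\<^sup>T ** P12) + A\<^sub>2\<^sub>2\<^sup>T ** P22 + \<epsilon> *\<^sub>R (P12\<^sup>T ** A\<^sub>1\<^sub>2) + P22 ** A\<^sub>2\<^sub>2
     + \<epsilon>\<^sup>2 *\<^sub>R (P12\<^sup>T ** \<Delta>\<^sub>1 ** P12) + \<epsilon> *\<^sub>R (P12\<^sup>T ** \<Delta> ** P22)
     + \<epsilon> *\<^sub>R (P22 ** \<Delta>\<^sup>T ** P12) + P22 ** \<Delta>\<^sub>2 ** P22 + Q\<^sub>2" for S (structure)

(* In the next four definitions, matrix_inv is the true inverse only when its argument is
   invertible. For Lambda this follows from the invertibility of Delta2 and the existence of a
   stabilising solution P: Lambda = transpose K ** matrix_inv Delta2 ** K, K = A22 + Delta2 ** P. *)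
definition Lambda :: "('n1::finite, 'n2::finite, 'k1::finite, 'k2::finite) riccati_data \<Rightarrow> real^'n2^'n2"
    ("\<Lambda>\<index>") where
  "\<Lambda> = A\<^sub>2\<^sub>2\<^sup>T ** matrix_inv \<Delta>\<^sub>2 ** A\<^sub>2\<^sub>2 - Q\<^sub>2" for S (structure)

definition A_red :: "('n1::finite, 'n2::finite, 'k1::finite, 'k2::finite) riccati_data \<Rightarrow> real^'n1^'n1" where
  "A_red S =
     A\<^sub>1\<^sub>1 - \<Delta> ** matrix_inv \<Delta>\<^sub>2 ** (\<Delta>\<^sub>2 - A\<^sub>2\<^sub>2 ** matrix_inv \<Lambda> ** A\<^sub>2\<^sub>2\<^sup>T) ** matrix_inv \<Delta>\<^sub>2 ** A\<^sub>2\<^sub>1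
     - A\<^sub>1\<^sub>2 ** matrix_inv \<Lambda> ** A\<^sub>2\<^sub>2\<^sup>T ** matrix_inv \<Delta>\<^sub>2 ** A\<^sub>2\<^sub>1" for S (structure)

definition M_red :: "('n1::finite, 'n2::finite, 'k1::finite, 'k2::finite) riccati_data \<Rightarrow> real^'n1^'n1" where
  "M_red S =
     \<Delta>\<^sub>1 + A\<^sub>1\<^sub>2 ** matrix_inv \<Lambda> ** A\<^sub>1\<^sub>2\<^sup>T
     - \<Delta> ** matrix_inv \<Delta>\<^sub>2 ** A\<^sub>2\<^sub>2 ** matrix_inv \<Lambda> ** A\<^sub>1\<^sub>2\<^sup>T
     - A\<^sub>1\<^sub>2 ** matrix_inv \<Lambda> ** A\<^sub>2\<^sub>2\<^sup>T ** matrix_inv \<Delta>\<^sub>2 ** \<Delta>\<^sup>T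
     - \<Delta> ** matrix_inv \<Delta>\<^sub>2 ** (\<Delta>\<^sub>2 - A\<^sub>2\<^sub>2 ** matrix_inv \<Lambda> ** A\<^sub>2\<^sub>2\<^sup>T) ** matrix_inv \<Delta>\<^sub>2 ** \<Delta>\<^sup>T"
  for S (structure)

definition N_red :: "('n1::finite, 'n2::finite, 'k1::finite, 'k2::finite) riccati_data \<Rightarrow> real^'n1^'n1" where
  "N_red S =
     Q\<^sub>1 - A\<^sub>2\<^sub>1\<^sup>T ** matrix_inv \<Delta>\<^sub>2 ** (\<Delta>\<^sub>2 - A\<^sub>2\<^sub>2 ** matrix_inv \<Lambda> ** A\<^sub>2\<^sub>2\<^sup>T) ** matrix_inv \<Delta>\<^sub>2 ** A\<^sub>2\<^sub>1"
  for S (structure)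

definition sym_matrices :: "(real^'n::finite^'n) set" where
  "sym_matrices = {X. X\<^sup>T = X}"

(* C([0,T]; X); a function on [0,T] is represented by a function on the reals whose values
   off [0,T] are irrelevant. *)
definition C_on :: "real \<Rightarrow> 'a::topological_space set \<Rightarrow> (real \<Rightarrow> 'a) set" where
  "C_on T X = {p. continuous_on {0..T} p \<and> p ` {0..T} \<subseteq> X}"

(* Eigenvalues of a real matrix are taken over the complex numbers. *)
definition complex_eigenvalue :: "real^'n::finite^'n \<Rightarrow> complex \<Rightarrow> bool" where
  "complex_eigenvalue A \<mu> \<longleftrightarrow>
     (\<exists>v. v \<noteq> 0 \<and> map_matrix complex_of_real A *v v = \<mu> *s v)"

definition stabilising_are_solution ::
  "('n1::finite, 'n2::finite, 'k1::finite, 'k2::finite) riccati_data \<Rightarrow> real^'n2^'n2 \<Rightarrow> bool" where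
  "stabilising_are_solution S P \<longleftrightarrow>
     P \<in> sym_matrices \<and>
     A\<^sub>2\<^sub>2\<^sup>T ** P + P ** A\<^sub>2\<^sub>2 + P ** \<Delta>\<^sub>2 ** P + Q\<^sub>2 = 0 \<and>
     (\<forall>\<mu>. complex_eigenvalue (A\<^sub>2\<^sub>2 + \<Delta>\<^sub>2 ** P) \<mu> \<longrightarrow> Re \<mu> < 0)" for S (structure)

(* Differentiability at the endpoints of [0,T] is one-sided. *)
definition reduced_dre_solution ::
  "('n1::finite, 'n2::finite, 'k1::finite, 'k2::finite) riccati_data \<Rightarrow> real \<Rightarrow>
     (real \<Rightarrow> real^'n1^'n1) \<Rightarrow> bool" where
  "reduced_dre_solution S T P \<longleftrightarrow>
     P \<in> C_on T sym_matrices \<and>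
     (\<forall>t\<in>{0..T}. \<exists>D. (P has_vector_derivative D) (at t within {0..T}) \<and>
        D + (A_red S)\<^sup>T ** P t + P t ** A_red S + P t ** M_red S ** P t + N_red S = 0) \<and>
     P T = 0"

definition reduced_system_solution ::
  "('n1::finite, 'n2::finite, 'k1::finite, 'k2::finite) riccati_data \<Rightarrow> real \<Rightarrow>
     (real \<Rightarrow> real^'n1^'n1) \<Rightarrow> (real \<Rightarrow> real^'n2^'n1) \<Rightarrow> real^'n2^'n2 \<Rightarrow> bool" where
  "reduced_system_solution S T P11 P12 P22 \<longleftrightarrow>
     (\<forall>t\<in>{0..T}. \<exists>D. (P11 has_vector_derivative D) (at t within {0..T}) \<and>
        D + ric_f S (P11 t) (P12 t) P22 0 = 0) \<and>
     P11 T = 0 \<and>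
     (\<forall>t\<in>{0..T}. ric_g1 S (P11 t) (P12 t) P22 0 = 0) \<and>
     (\<forall>t\<in>{0..T}. ric_g2 S (P11 t) (P12 t) P22 0 = 0)" for S (structure)

end

theory Submission
  imports Defs
begin

text \<open>
  At \<open>\<epsilon> = 0\<close> the equation \<open>g\<^sub>2 = 0\<close> is the reduced algebraic Riccati equation, and \<open>g\<^sub>1 = 0\<close> is
  linear in \<open>P\<^sub>1\<^sub>2\<close>: it reads \<open>L + P\<^sub>1\<^sub>2 K = 0\<close>, where \<open>K = A\<^sub>2\<^sub>2 + \<Delta>\<^sub>2 P\<^sub>2\<^sub>2\<close> and
  \<open>L = A\<^sub>2\<^sub>1\<^sup>T P\<^sub>2\<^sub>2 + P\<^sub>1\<^sub>1 A\<^sub>1\<^sub>2 + P\<^sub>1\<^sub>1 \<Delta> P\<^sub>2\<^sub>2\<close>. If \<open>P\<^sub>2\<^sub>2\<close> is stabilising, then \<open>0\<close> is not an eigenvalue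
  of \<open>K\<close>, so \<open>K\<close> is invertible (\<open>Hurwitz_invertible\<close>) and the given \<open>P\<^sub>1\<^sub>2\<close> is the solution
  \<open>- L K\<inverse>\<close>. It remains to see that substituting this \<open>P\<^sub>1\<^sub>2\<close> in \<open>f\<close> gives the quadratic polynomial
  of the reduced differential Riccati equation, in which \<open>P\<^sub>2\<^sub>2\<close> no longer occurs
  (\<open>ric_f_elimination\<close>).

  Two facts eliminate \<open>P\<^sub>2\<^sub>2\<close>. The algebraic Riccati equation says that \<open>\<Lambda>\<close> factors as
  \<open>K\<^sup>T \<Delta>\<^sub>2\<inverse> K\<close>, so that \<open>\<Lambda>\<inverse> = K\<inverse> \<Delta>\<^sub>2 (K\<inverse>)\<^sup>T\<close> (\<open>matrix_inv_Lambda\<close>). And with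
  \<open>W = A\<^sub>2\<^sub>1\<^sup>T + P\<^sub>1\<^sub>1 \<Delta>\<close> and \<open>R = P\<^sub>1\<^sub>1 A\<^sub>1\<^sub>2 - W \<Delta>\<^sub>2\<inverse> A\<^sub>2\<^sub>2\<close>, the identity \<open>P\<^sub>2\<^sub>2 = \<Delta>\<^sub>2\<inverse> (K - A\<^sub>2\<^sub>2)\<close>
  gives \<open>L = W \<Delta>\<^sub>2\<inverse> K + R\<close>. The terms of \<open>f\<close> that contain \<open>P\<^sub>1\<^sub>2\<close> are
  \<open>W P\<^sub>1\<^sub>2\<^sup>T + P\<^sub>1\<^sub>2 W\<^sup>T + P\<^sub>1\<^sub>2 \<Delta>\<^sub>2 P\<^sub>1\<^sub>2\<^sup>T\<close>; completing the square (\<open>complete_square\<close>) turns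
  them into \<open>R \<Lambda>\<inverse> R\<^sup>T - W \<Delta>\<^sub>2\<inverse> W\<^sup>T\<close>, where only \<open>P\<^sub>1\<^sub>1\<close> is left. Sorting this expression
  by its degree in \<open>P\<^sub>1\<^sub>1\<close> yields the three coefficients of the reduced equation.
\<close>

lemma matrix_mul_minus_left: "(- A) ** B = - (A ** B)"
  for A :: "real^'n::finite^'m"
  by (simp add: matrix_matrix_mult_def vec_eq_iff sum_negf)

lemma matrix_mul_minus_right: "A ** (- B) = - (A ** B)"
  for A :: "real^'n::finite^'m"
  by (simp add: matrix_matrix_mult_def vec_eq_iff sum_negf)

lemma matrix_add_rdistrib: "(A + B) ** C = A ** C + B ** C"
  for A :: "real^'n::finite^'m"
  by (simp add: matrix_matrix_mult_def vec_eq_iff sum.distrib algebra_simps)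

lemma matrix_diff_ldistrib: "A ** (B - C) = A ** B - A ** C"
  for A :: "real^'n::finite^'m"
  by (simp add: matrix_matrix_mult_def vec_eq_iff sum_subtractf algebra_simps)

lemma matrix_diff_rdistrib: "(A - B) ** C = A ** C - B ** C"
  for A :: "real^'n::finite^'m"
  by (simp add: matrix_matrix_mult_def vec_eq_iff sum_subtractf algebra_simps)

lemma transpose_add: "(A + B)\<^sup>T = A\<^sup>T + B\<^sup>T"
  by (simp add: transpose_def vec_eq_iff)

lemma transpose_diff: "(A - B)\<^sup>T = A\<^sup>T - B\<^sup>T"
  for A :: "real^'n::finite^'m"
  by (simp add: transpose_def vec_eq_iff)

lemma transpose_minus: "(- A)\<^sup>T = - A\<^sup>T"
  for A :: "real^'n::finite^'m"
  by (simp add: transpose_def vec_eq_iff)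

lemmas matrix_expand =
  matrix_add_ldistrib matrix_add_rdistrib matrix_diff_ldistrib matrix_diff_rdistrib
  matrix_mul_minus_left matrix_mul_minus_right
  transpose_add transpose_diff transpose_minus matrix_transpose_mul transpose_transpose
  matrix_mul_assoc

lemma matrix_inv_mult:
  fixes A :: "real^'n::finite^'n"
  assumes "invertible A"
  shows "A ** matrix_inv A = mat 1" "matrix_inv A ** A = mat 1"
  using someI_ex[OF assms[unfolded invertible_def]] unfolding matrix_inv_def by auto

lemma matrix_inv_unique:
  fixes A B :: "real^'n::finite^'n"
  assumes "A ** B = mat 1"
  shows "matrix_inv A = B"
proof -
  have "invertible A"
    using assms invertible_right_inverse by blast
  then have "B = matrix_inv A ** (A ** B)"
    by (simp add: matrix_mul_assoc matrix_inv_mult)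
  then show ?thesis
    by (simp add: assms)
qed

lemma matrix_inv_symmetric:
  fixes A :: "real^'n::finite^'n"
  assumes "invertible A" "A\<^sup>T = A"
  shows "(matrix_inv A)\<^sup>T = matrix_inv A"
proof -
  have "A ** (matrix_inv A)\<^sup>T = (matrix_inv A ** A)\<^sup>T"
    by (simp add: matrix_transpose_mul assms(2))
  also have "\<dots> = mat 1"
    by (simp add: matrix_inv_mult assms(1))
  finally show ?thesis
    using matrix_inv_unique by metis
qed

lemma continuous_on_matrix_mul:
  fixes f :: "'a::topological_space \<Rightarrow> real^'n::finite^'m::finite"
    and g :: "'a \<Rightarrow> real^'k::finite^'n"
  assumes "continuous_on X f" "continuous_on X g"
  shows "continuous_on X (\<lambda>x. f x ** g x)"
  unfolding matrix_matrix_mult_def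
  using assms by (intro continuous_intros)

text \<open>A real kernel vector, read over the complex numbers, is an eigenvector for the eigenvalue 0.\<close>
lemma Hurwitz_invertible:
  fixes A :: "real^'n::finite^'n"
  assumes "\<And>\<mu>. complex_eigenvalue A \<mu> \<Longrightarrow> Re \<mu> < 0"
  shows "invertible A"
proof -
  have "x = 0" if "A *v x = 0" for x
  proof (rule ccontr)
    assume "x \<noteq> 0"
    define v :: "complex^'n" where "v = (\<chi> i. complex_of_real (x $ i))"
    have "v \<noteq> 0"
      using \<open>x \<noteq> 0\<close> by (auto simp: v_def vec_eq_iff)
    moreover have "(map_matrix complex_of_real A *v v) $ i = complex_of_real ((A *v x) $ i)" for i
      by (simp add: matrix_vector_mult_def v_def)
    then have "map_matrix complex_of_real A *v v = 0 *s v"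
      using that by (simp add: vec_eq_iff)
    ultimately have "complex_eigenvalue A 0"
      unfolding complex_eigenvalue_def by blast
    with assms[of 0] show False
      by simp
  qed
  then have "\<exists>B. B ** A = mat 1"
    by (simp add: matrix_left_invertible_ker)
  then show ?thesis
    by (simp add: invertible_left_inverse)
qed

text \<open>
  For invertible symmetric \<open>D\<close> the left-hand side is \<open>(Y + W D\<inverse>) D (Y + W D\<inverse>)\<^sup>T - W D\<inverse> W\<^sup>T\<close>, and
  the \<open>Y\<close> considered here is such that \<open>Y + W D\<inverse> = - R K\<inverse>\<close>. The letters \<open>E\<close> and \<open>Z\<close> stand for
  \<open>D\<inverse>\<close> and \<open>K\<inverse>\<close>.
\<close>
lemma complete_square:
  fixes W R :: "real^'n::finite^'m::finite" and K D E Z :: "real^'n^'n"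
  assumes DE: "D ** E = mat 1" "E\<^sup>T = E" "D\<^sup>T = D"
    and KZ: "K ** Z = mat 1"
    and Y: "Y = - (W ** E ** K + R) ** Z"
  shows "W ** Y\<^sup>T + Y ** W\<^sup>T + Y ** D ** Y\<^sup>T = R ** (Z ** D ** Z\<^sup>T) ** R\<^sup>T - W ** E ** W\<^sup>T"
proof -
  have "E ** D = mat 1"
    using DE(1) matrix_left_right_inverse by blast
  then have Y': "Y = - (W ** E) - R ** Z"
    and YD: "Y ** D = - W - R ** Z ** D"
    using KZ by (simp_all add: Y matrix_expand flip: matrix_mul_assoc)
  \<comment> \<open>The part \<open>- W\<close> of \<open>Y D\<close> cancels the term \<open>W Y\<^sup>T\<close>.\<close>
  have "W ** Y\<^sup>T + Y ** D ** Y\<^sup>T = - (R ** Z ** D ** Y\<^sup>T)"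
    by (simp add: YD matrix_expand)
  also have "\<dots> = R ** Z ** W\<^sup>T + R ** (Z ** D ** Z\<^sup>T) ** R\<^sup>T"
  proof -
    have "D ** Y\<^sup>T = (Y ** D)\<^sup>T"
      by (simp add: matrix_transpose_mul DE)
    also have "\<dots> = - W\<^sup>T - D ** Z\<^sup>T ** R\<^sup>T"
      by (simp add: YD matrix_expand DE)
    finally have DY: "D ** Y\<^sup>T = - W\<^sup>T - D ** Z\<^sup>T ** R\<^sup>T" .
    have "R ** Z ** D ** Y\<^sup>T = R ** Z ** (D ** Y\<^sup>T)"
      by (simp add: matrix_mul_assoc)
    then show ?thesis
      by (simp add: DY matrix_expand)
  qed
  finally have "W ** Y\<^sup>T + Y ** D ** Y\<^sup>T = R ** Z ** W\<^sup>T + R ** (Z ** D ** Z\<^sup>T) ** R\<^sup>T" .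
  moreover have "Y ** W\<^sup>T = - (W ** E ** W\<^sup>T) - R ** Z ** W\<^sup>T"
    by (simp add: Y' matrix_expand)
  moreover have "W ** Y\<^sup>T + Y ** W\<^sup>T + Y ** D ** Y\<^sup>T = W ** Y\<^sup>T + Y ** D ** Y\<^sup>T + Y ** W\<^sup>T"
    by (simp add: ac_simps)
  ultimately show ?thesis
    by simp
qed

lemma Delta2_symmetric: "\<Delta>\<^sub>2\<^sup>T = \<Delta>\<^sub>2"
  for S :: "('n1::finite, 'n2::finite, 'k1::finite, 'k2::finite) riccati_data" (structure)
  by (simp add: Delta2_def matrix_expand)

text \<open>
  Expanding \<open>K\<^sup>T \<Delta>\<^sub>2\<inverse> K\<close> for \<open>K = A\<^sub>2\<^sub>2 + \<Delta>\<^sub>2 P\<close> gives \<open>A\<^sub>2\<^sub>2\<^sup>T \<Delta>\<^sub>2\<inverse> A\<^sub>2\<^sub>2\<close> plus the part of the algebraic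
  Riccati equation that contains \<open>P\<close>. By that equation this part is \<open>- Q\<^sub>2\<close>, so the product
  is \<open>\<Lambda>\<close>, and inverting the three factors gives the claim.
\<close>
lemma matrix_inv_Lambda:
  fixes S :: "('n1::finite, 'n2::finite, 'k1::finite, 'k2::finite) riccati_data" (structure)
  assumes inv: "invertible \<Delta>\<^sub>2" and P: "P \<in> sym_matrices"
    and are: "A\<^sub>2\<^sub>2\<^sup>T ** P + P ** A\<^sub>2\<^sub>2 + P ** \<Delta>\<^sub>2 ** P + Q\<^sub>2 = 0"
    and K: "invertible (A\<^sub>2\<^sub>2 + \<Delta>\<^sub>2 ** P)"
  defines "Z \<equiv> matrix_inv (A\<^sub>2\<^sub>2 + \<Delta>\<^sub>2 ** P)"
  shows "matrix_inv \<Lambda> = Z ** \<Delta>\<^sub>2 ** Z\<^sup>T"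
proof (rule matrix_inv_unique)
  let ?K = "A\<^sub>2\<^sub>2 + \<Delta>\<^sub>2 ** P" and ?E = "matrix_inv \<Delta>\<^sub>2"
  have PT: "P\<^sup>T = P"
    using P by (simp add: sym_matrices_def)
  have E: "\<Delta>\<^sub>2 ** ?E = mat 1" "?E ** \<Delta>\<^sub>2 = mat 1"
    using inv by (rule matrix_inv_mult)+
  have Z: "?K ** Z = mat 1" "Z ** ?K = mat 1"
    unfolding Z_def using K by (rule matrix_inv_mult)+
  have EK: "?E ** ?K = ?E ** A\<^sub>2\<^sub>2 + P"
    by (simp add: matrix_add_ldistrib matrix_mul_assoc E)
  have DE: "U ** \<Delta>\<^sub>2 ** ?E = U" and ED: "U ** ?E ** \<Delta>\<^sub>2 = U" for U :: "real^'n2^'n2"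
    by (simp_all add: E flip: matrix_mul_assoc)
  have "?K\<^sup>T ** ?E ** ?K = ?K\<^sup>T ** (?E ** ?K)"
    by (simp add: matrix_mul_assoc)
  also have "\<dots> = A\<^sub>2\<^sub>2\<^sup>T ** ?E ** A\<^sub>2\<^sub>2 + (A\<^sub>2\<^sub>2\<^sup>T ** P + P ** A\<^sub>2\<^sub>2 + P ** \<Delta>\<^sub>2 ** P)"
    by (simp add: EK matrix_expand PT Delta2_symmetric DE ED)
  also have "A\<^sub>2\<^sub>2\<^sup>T ** P + P ** A\<^sub>2\<^sub>2 + P ** \<Delta>\<^sub>2 ** P = - Q\<^sub>2"
    using are by (rule eq_neg_iff_add_eq_0[THEN iffD2])
  finally have L: "\<Lambda> = ?K\<^sup>T ** ?E ** ?K"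
    by (simp add: Lambda_def)
  have "\<Lambda> ** (Z ** \<Delta>\<^sub>2 ** Z\<^sup>T) = ?K\<^sup>T ** (?E ** (?K ** Z) ** \<Delta>\<^sub>2) ** Z\<^sup>T"
    by (simp only: L matrix_mul_assoc)
  also have "\<dots> = (Z ** ?K)\<^sup>T"
    by (simp add: Z(1) E(2) matrix_transpose_mul)
  finally show "\<Lambda> ** (Z ** \<Delta>\<^sub>2 ** Z\<^sup>T) = mat 1"
    by (simp add: Z(2))
qed

text \<open>
  The elimination is pointwise in time: \<open>X\<close> and \<open>Y\<close> are the values of \<open>P\<^sub>1\<^sub>1\<close> and \<open>P\<^sub>1\<^sub>2\<close>. Symmetry
  of \<open>X\<close> is what makes \<open>Y W\<^sup>T\<close> and \<open>W Y\<^sup>T\<close>, with the single matrix \<open>W = A\<^sub>2\<^sub>1\<^sup>T + X \<Delta>\<close>,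
  account for all the terms of \<open>f\<close> that are linear in \<open>Y\<close>.
\<close>
lemma ric_f_elimination:
  fixes S :: "('n1::finite, 'n2::finite, 'k1::finite, 'k2::finite) riccati_data" (structure)
    and X :: "real^'n1^'n1" and P :: "real^'n2^'n2"
  assumes inv: "invertible \<Delta>\<^sub>2" and P: "P \<in> sym_matrices"
    and are: "A\<^sub>2\<^sub>2\<^sup>T ** P + P ** A\<^sub>2\<^sub>2 + P ** \<Delta>\<^sub>2 ** P + Q\<^sub>2 = 0"
    and K: "invertible (A\<^sub>2\<^sub>2 + \<Delta>\<^sub>2 ** P)"
    and X: "X \<in> sym_matrices"
    and Y: "Y = - (A\<^sub>2\<^sub>1\<^sup>T ** P + X ** A\<^sub>1\<^sub>2 + X ** \<Delta> ** P) ** matrix_inv (A\<^sub>2\<^sub>2 + \<Delta>\<^sub>2 ** P)"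
  shows "ric_f S X Y P \<epsilon> = (A_red S)\<^sup>T ** X + X ** A_red S + X ** M_red S ** X + N_red S"
proof -
  let ?K = "A\<^sub>2\<^sub>2 + \<Delta>\<^sub>2 ** P" and ?E = "matrix_inv \<Delta>\<^sub>2"
  define Z where "Z = matrix_inv ?K"
  define W where "W = A\<^sub>2\<^sub>1\<^sup>T + X ** \<Delta>"
  define R where "R = X ** A\<^sub>1\<^sub>2 - W ** ?E ** A\<^sub>2\<^sub>2"
  have PT: "P\<^sup>T = P" and XT: "X\<^sup>T = X"
    using P X by (simp_all add: sym_matrices_def)
  have E: "\<Delta>\<^sub>2 ** ?E = mat 1" "?E ** \<Delta>\<^sub>2 = mat 1"
    using inv by (rule matrix_inv_mult)+
  have inv_cancel: "U ** ?E ** \<Delta>\<^sub>2 = U" for U :: "real^'n2^'n1"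
    by (simp add: E flip: matrix_mul_assoc)
  have ET: "?E\<^sup>T = ?E"
    using inv Delta2_symmetric by (rule matrix_inv_symmetric)
  have KZ: "?K ** Z = mat 1"
    unfolding Z_def using K by (rule matrix_inv_mult)
  have LI: "matrix_inv \<Lambda> = Z ** \<Delta>\<^sub>2 ** Z\<^sup>T"
    unfolding Z_def using inv P are K by (rule matrix_inv_Lambda)
  then have LT: "(matrix_inv \<Lambda>)\<^sup>T = matrix_inv \<Lambda>"
    by (simp add: matrix_expand Delta2_symmetric)
  have "?E ** ?K = ?E ** A\<^sub>2\<^sub>2 + P"
    by (simp add: matrix_add_ldistrib matrix_mul_assoc E)
  then have "W ** ?E ** ?K + R = W ** P + X ** A\<^sub>1\<^sub>2"
    by (simp add: R_def matrix_add_ldistrib flip: matrix_mul_assoc)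
  also have "\<dots> = A\<^sub>2\<^sub>1\<^sup>T ** P + X ** A\<^sub>1\<^sub>2 + X ** \<Delta> ** P"
    by (simp add: W_def matrix_add_rdistrib)
  finally have "Y = - (W ** ?E ** ?K + R) ** Z"
    by (simp add: Y Z_def)
  then have sq: "W ** Y\<^sup>T + Y ** W\<^sup>T + Y ** \<Delta>\<^sub>2 ** Y\<^sup>T
      = R ** matrix_inv \<Lambda> ** R\<^sup>T - W ** ?E ** W\<^sup>T"
    unfolding LI using E(1) ET Delta2_symmetric KZ by (intro complete_square)
  have "ric_f S X Y P \<epsilon> = A\<^sub>1\<^sub>1\<^sup>T ** X + X ** A\<^sub>1\<^sub>1 + X ** \<Delta>\<^sub>1 ** X + Q\<^sub>1
      + (W ** Y\<^sup>T + Y ** W\<^sup>T + Y ** \<Delta>\<^sub>2 ** Y\<^sup>T)"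
    by (simp add: ric_f_def W_def matrix_expand XT)
  also have "\<dots> = (A_red S)\<^sup>T ** X + X ** A_red S + X ** M_red S ** X + N_red S"
    unfolding sq unfolding R_def W_def A_red_def M_red_def N_red_def
    by (simp add: matrix_expand XT ET LT Delta2_symmetric inv_cancel)
  finally show ?thesis .
qed

theorem theorem3p6:
  fixes S :: "('n1::finite, 'n2::finite, 'k1::finite, 'k2::finite) riccati_data" (structure)
    and T :: real
    and P11 :: "real \<Rightarrow> real^'n1^'n1"
    and P12 :: "real \<Rightarrow> real^'n2^'n1"
    and P22 :: "real^'n2^'n2"
  assumes T_pos: "T > 0"
    and Q_sym: "Q\<^sub>1 \<in> sym_matrices" "Q\<^sub>2 \<in> sym_matrices"
    and Delta2_inv: "invertible \<Delta>\<^sub>2"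
    and P22: "stabilising_are_solution S P22"
    and P11: "reduced_dre_solution S T P11"
    and P11_unique: "\<And>P. reduced_dre_solution S T P \<Longrightarrow> \<forall>t\<in>{0..T}. P t = P11 t"
    and P12: "\<And>t. t \<in> {0..T} \<Longrightarrow>
      P12 t = - (A\<^sub>2\<^sub>1\<^sup>T ** P22 + P11 t ** A\<^sub>1\<^sub>2 + P11 t ** \<Delta> ** P22)
              ** matrix_inv (A\<^sub>2\<^sub>2 + \<Delta>\<^sub>2 ** P22)"
  shows "(P11, P12, P22) \<in> C_on T sym_matrices \<times> C_on T UNIV \<times> sym_matrices
    \<and> reduced_system_solution S T P11 P12 P22"
proof -
  let ?K = "A\<^sub>2\<^sub>2 + \<Delta>\<^sub>2 ** P22"
  have sym: "P22 \<in> sym_matrices"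
    and are: "A\<^sub>2\<^sub>2\<^sup>T ** P22 + P22 ** A\<^sub>2\<^sub>2 + P22 ** \<Delta>\<^sub>2 ** P22 + Q\<^sub>2 = 0"
    and K: "invertible ?K"
    using P22 Hurwitz_invertible[of ?K] by (auto simp: stabilising_are_solution_def)
  have P11_C: "P11 \<in> C_on T sym_matrices" and P11_T: "P11 T = 0"
    using P11 by (simp_all add: reduced_dre_solution_def)
  then have P11_sym: "P11 t \<in> sym_matrices" if "t \<in> {0..T}" for t
    using that by (auto simp: C_on_def)
  have "continuous_on {0..T} P12"
  proof (subst continuous_on_cong[OF refl P12])
    show "continuous_on {0..T} (\<lambda>t. - (A\<^sub>2\<^sub>1\<^sup>T ** P22 + P11 t ** A\<^sub>1\<^sub>2 + P11 t ** \<Delta> ** P22)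
              ** matrix_inv ?K)"
      using P11_C unfolding C_on_def by (intro continuous_intros continuous_on_matrix_mul) auto
  qed auto
  then have P12_C: "P12 \<in> C_on T UNIV"
    by (simp add: C_on_def)
  have f: "\<exists>D. (P11 has_vector_derivative D) (at t within {0..T})
      \<and> D + ric_f S (P11 t) (P12 t) P22 0 = 0" if "t \<in> {0..T}" for t
    using P11 that
    unfolding reduced_dre_solution_def
      ric_f_elimination[OF Delta2_inv sym are K P11_sym[OF that] P12[OF that]]
    by (simp add: add.assoc)
  have g1: "ric_g1 S (P11 t) (P12 t) P22 0 = 0" if "t \<in> {0..T}" for t
  proof -
    let ?L = "A\<^sub>2\<^sub>1\<^sup>T ** P22 + P11 t ** A\<^sub>1\<^sub>2 + P11 t ** \<Delta> ** P22"
    have "P12 t ** ?K = - ?L ** (matrix_inv ?K ** ?K)"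
      by (simp only: P12[OF that] matrix_mul_assoc)
    then have "P12 t ** ?K = - ?L"
      using K by (simp add: matrix_inv_mult)
    moreover have "ric_g1 S (P11 t) (P12 t) P22 0 = ?L + P12 t ** ?K"
      by (simp add: ric_g1_def matrix_add_ldistrib matrix_mul_assoc)
    ultimately show ?thesis
      by simp
  qed
  have g2: "ric_g2 S (P11 t) (P12 t) P22 0 = 0" for t
    using are by (simp add: ric_g2_def)
  show ?thesis
    using P11_C P12_C sym P11_T f g1 g2 by (simp add: reduced_system_solution_def)
qed

end
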